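(* The satisfiability problem for $\exists^*\forall^*\mathsf{SL}(\mathsf{ELIA})_{U,U\times\mathsf{Int}}$ is undecidable: there is no algorithm which, given a sentence $\exists x_1\ldots\exists x_m\forall y_1\ldots\forall y_n ~.~\varphi$ with $\varphi$ a quantifier-free $\mathsf{SL}(\mathsf{ELIA})_{U,U\times\mathsf{Int}}$ formula (quantified variables of sort $U$ or $\mathsf{Int}$), decides whether it has a model.
   Context: $\mathsf{ELIA}$ is the theory whose signature extends linear integer arithmetic (sort $\mathsf{Int}$ interpreted as the integers, with $\geq$, $+$, $0$, $1$ interpreted as usual) with an uninterpreted sort $U$ (any nonempty countable set) equipped only with equality. $\mathsf{SL}(\mathsf{ELIA})_{U,U\times \mathsf{Int}}$ is separation logic with locations of sort $U$ and data of sort $U\times\mathsf{Int}$ (points-to atoms written $t\mapsto (d,u)$ or with the data tuple in the sort's order): formulas are generated by $\varphi ::= \phi \mid \mathsf{emp} \mid t \mapsto u \mid \varphi_1 * \varphi_2 \mid \varphi_1 \mathrel{-\!\!*} \varphi_2 \mid \neg\varphi_1 \mid \varphi_1 \wedge \varphi_2 \mid \exists x ~.~ \varphi_1$, where $\phi$ is an $\mathsf{ELIA}$ formula, $t$ a term of sort $U$, $u$ a term of the data sort; $\forall$ abbreviates $\neg\exists\neg$; $\mathsf{nil}$ is a designated constant of sort $U$. A heap is a finite partial function from $U^\mathcal{I}$ to $U^\mathcal{I}\times\mathbb{Z}$. Semantics: $\mathcal{I},h \models \phi$ iff $\mathcal{I} \models \phi$ for first-order $\phi$; $\mathcal{I},h\models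 \mathsf{emp}$ iff $h=\emptyset$; $\mathcal{I},h \models t\mapsto u$ iff $h=\{(t^\mathcal{I},u^\mathcal{I})\}$ and $t^\mathcal{I}\neq \mathsf{nil}^\mathcal{I}$; $\mathcal{I},h\models \varphi_1*\varphi_2$ iff $h = h_1 \uplus h_2$ (disjoint domains) with $\mathcal{I},h_i\models\varphi_i$; $\mathcal{I},h\models \varphi_1\mathrel{-\!\!*}\varphi_2$ iff for every heap $h'$ with domain disjoint from $\mathrm{dom}(h)$ and $\mathcal{I},h'\models\varphi_1$, $\mathcal{I},h'\uplus h\models\varphi_2$; $\mathcal{I},h\models\exists x^\sigma.\varphi$ iff $\mathcal{I}[x\leftarrow s],h\models\varphi$ for some $s\in\sigma^\mathcal{I}$; Boolean connectives are classical. A sentence is satisfiable if some model $\mathcal{I}$ of $\mathsf{ELIA}$ and heap $h$ satisfy it. *)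

theory Defs
  imports Main "HOL-Library.Nat_Bijection"
begin

datatype recf =
    RZ
  | RS
  | RId nat
  | RCn recf "recf list"
  | RPr recf recf
  | RMn recf

inductive rec_eval :: "recf \<Rightarrow> nat list \<Rightarrow> nat \<Rightarrow> bool" where
  ev_Z:  "rec_eval RZ xs 0"
| ev_S:  "rec_eval RS (x # xs) (Suc x)"
| ev_Id: "i < length xs \<Longrightarrow> rec_eval (RId i) xs (xs ! i)"
| ev_Cn: "length ys = length gs \<Longrightarrow> (\<forall>i < length gs. rec_eval (gs ! i) xs (ys ! i))
          \<Longrightarrow> rec_eval f ys z \<Longrightarrow> rec_eval (RCn f gs) xs z"
| ev_Pr0: "rec_eval f xs y \<Longrightarrow> rec_eval (RPr f g) (0 # xs) y"
| ev_PrS: "rec_eval (RPr f g) (n # xs) y \<Longrightarrow> rec_eval g (n # y # xs) z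
          \<Longrightarrow> rec_eval (RPr f g) (Suc n # xs) z"
| ev_Mn: "rec_eval f (n # xs) 0 \<Longrightarrow> (\<forall>m < n. \<exists>y > 0. rec_eval f (m # xs) y)
          \<Longrightarrow> rec_eval (RMn f) xs n"

datatype uterm = UVar nat | UNil
datatype iterm = IVar nat | IZero | IOne | IPlus iterm iterm

datatype slf =
    EqU uterm uterm
  | GeI iterm iterm
  | Emp
  | PointsTo uterm uterm iterm
  | Sep slf slf
  | Wand slf slf
  | Neg slf
  | Conj slf slf
  | ExU nat slf
  | ExI nat slf

definition AllU :: "nat \<Rightarrow> slf \<Rightarrow> slf" where "AllU x \<phi> = Neg (ExU x (Neg \<phi>))"
definition AllI :: "nat \<Rightarrow> slf \<Rightarrow> slf" where "AllI x \<phi> = Neg (ExI x (Neg \<phi>))"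

primrec qfree :: "slf \<Rightarrow> bool" where
  "qfree (EqU a b) = True"
| "qfree (GeI a b) = True"
| "qfree Emp = True"
| "qfree (PointsTo t d u) = True"
| "qfree (Sep a b) = (qfree a \<and> qfree b)"
| "qfree (Wand a b) = (qfree a \<and> qfree b)"
| "qfree (Neg a) = qfree a"
| "qfree (Conj a b) = (qfree a \<and> qfree b)"
| "qfree (ExU x a) = False"
| "qfree (ExI x a) = False"

primrec fvu_t :: "uterm \<Rightarrow> nat set" where
  "fvu_t (UVar x) = {x}" | "fvu_t UNil = {}"
primrec fvi_t :: "iterm \<Rightarrow> nat set" where
  "fvi_t (IVar x) = {x}" | "fvi_t IZero = {}" | "fvi_t IOne = {}"
| "fvi_t (IPlus a b) = fvi_t a \<union> fvi_t b"

primrec fvU :: "slf \<Rightarrow> nat set" where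
  "fvU (EqU a b) = fvu_t a \<union> fvu_t b"
| "fvU (GeI a b) = {}"
| "fvU Emp = {}"
| "fvU (PointsTo t d u) = fvu_t t \<union> fvu_t d"
| "fvU (Sep a b) = fvU a \<union> fvU b"
| "fvU (Wand a b) = fvU a \<union> fvU b"
| "fvU (Neg a) = fvU a"
| "fvU (Conj a b) = fvU a \<union> fvU b"
| "fvU (ExU x a) = fvU a - {x}"
| "fvU (ExI x a) = fvU a"

primrec fvI :: "slf \<Rightarrow> nat set" where
  "fvI (EqU a b) = {}"
| "fvI (GeI a b) = fvi_t a \<union> fvi_t b"
| "fvI Emp = {}"
| "fvI (PointsTo t d u) = fvi_t u"
| "fvI (Sep a b) = fvI a \<union> fvI b"
| "fvI (Wand a b) = fvI a \<union> fvI b"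
| "fvI (Neg a) = fvI a"
| "fvI (Conj a b) = fvI a \<union> fvI b"
| "fvI (ExU x a) = fvI a"
| "fvI (ExI x a) = fvI a - {x}"

definition sentence :: "slf \<Rightarrow> bool" where
  "sentence \<phi> \<longleftrightarrow> fvU \<phi> = {} \<and> fvI \<phi> = {}"

inductive all_prefix :: "slf \<Rightarrow> bool" where
  "qfree \<phi> \<Longrightarrow> all_prefix \<phi>"
| "all_prefix \<phi> \<Longrightarrow> all_prefix (AllU x \<phi>)"
| "all_prefix \<phi> \<Longrightarrow> all_prefix (AllI x \<phi>)"

inductive ea_prefix :: "slf \<Rightarrow> bool" where
  "all_prefix \<phi> \<Longrightarrow> ea_prefix \<phi>"
| "ea_prefix \<phi> \<Longrightarrow> ea_prefix (ExU x \<phi>)"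
| "ea_prefix \<phi> \<Longrightarrow> ea_prefix (ExI x \<phi>)"

definition ea_sentence :: "slf \<Rightarrow> bool" where
  "ea_sentence \<phi> \<longleftrightarrow> ea_prefix \<phi> \<and> sentence \<phi>"

text \<open>The domain of U is a nonempty set D of naturals (every nonempty countable set
  is in bijection with one); nl is the interpretation of nil.
  Heaps are finite partial maps D -> D x Int.\<close>

type_synonym heap = "nat \<Rightarrow> (nat \<times> int) option"

definition heap_ok :: "nat set \<Rightarrow> heap \<Rightarrow> bool" where
  "heap_ok D h \<longleftrightarrow> finite (dom h) \<and> dom h \<subseteq> D \<and> fst ` ran h \<subseteq> D"

primrec uval :: "nat \<Rightarrow> (nat \<Rightarrow> nat) \<Rightarrow> uterm \<Rightarrow> nat" where
  "uval nl su (UVar x) = su x" | "uval nl su UNil = nl"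

primrec ival :: "(nat \<Rightarrow> int) \<Rightarrow> iterm \<Rightarrow> int" where
  "ival si (IVar x) = si x" | "ival si IZero = 0" | "ival si IOne = 1"
| "ival si (IPlus a b) = ival si a + ival si b"

primrec sem :: "nat set \<Rightarrow> nat \<Rightarrow> (nat \<Rightarrow> nat) \<Rightarrow> (nat \<Rightarrow> int) \<Rightarrow> heap \<Rightarrow> slf \<Rightarrow> bool" where
  "sem D nl su si h (EqU a b) = (uval nl su a = uval nl su b)"
| "sem D nl su si h (GeI a b) = (ival si a \<ge> ival si b)"
| "sem D nl su si h Emp = (h = Map.empty)"
| "sem D nl su si h (PointsTo t d u) =
     (h = [uval nl su t \<mapsto> (uval nl su d, ival si u)] \<and> uval nl su t \<noteq> nl)"
| "sem D nl su si h (Sep a b) =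
     (\<exists>h1 h2. dom h1 \<inter> dom h2 = {} \<and> h = h1 ++ h2 \<and> sem D nl su si h1 a \<and> sem D nl su si h2 b)"
| "sem D nl su si h (Wand a b) =
     (\<forall>h'. heap_ok D h' \<and> dom h' \<inter> dom h = {} \<and> sem D nl su si h' a \<longrightarrow> sem D nl su si (h' ++ h) b)"
| "sem D nl su si h (Neg a) = (\<not> sem D nl su si h a)"
| "sem D nl su si h (Conj a b) = (sem D nl su si h a \<and> sem D nl su si h b)"
| "sem D nl su si h (ExU x a) = (\<exists>v \<in> D. sem D nl (su(x := v)) si h a)"
| "sem D nl su si h (ExI x a) = (\<exists>v. sem D nl su (si(x := v)) h a)"

definition satisfiable :: "slf \<Rightarrow> bool" where
  "satisfiable \<phi> \<longleftrightarrow> (\<exists>D nl su si h. D \<noteq> {} \<and> nl \<in> D \<and> (\<forall>x. su x \<in> D) \<and> heap_ok D h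
                        \<and> sem D nl su si h \<phi>)"

primrec code_u :: "uterm \<Rightarrow> nat" where
  "code_u (UVar x) = prod_encode (0, x)" | "code_u UNil = prod_encode (1, 0)"

primrec code_i :: "iterm \<Rightarrow> nat" where
  "code_i (IVar x) = prod_encode (0, x)"
| "code_i IZero = prod_encode (1, 0)"
| "code_i IOne = prod_encode (2, 0)"
| "code_i (IPlus a b) = prod_encode (3, prod_encode (code_i a, code_i b))"

primrec code :: "slf \<Rightarrow> nat" where
  "code (EqU a b) = prod_encode (0, prod_encode (code_u a, code_u b))"
| "code (GeI a b) = prod_encode (1, prod_encode (code_i a, code_i b))"
| "code Emp = prod_encode (2, 0)"
| "code (PointsTo t d u) = prod_encode (3, prod_encode (code_u t, prod_encode (code_u d, code_i u)))"
| "code (Sep a b) = prod_encode (4, prod_encode (code a, code b))"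
| "code (Wand a b) = prod_encode (5, prod_encode (code a, code b))"
| "code (Neg a) = prod_encode (6, code a)"
| "code (Conj a b) = prod_encode (7, prod_encode (code a, code b))"
| "code (ExU x a) = prod_encode (8, prod_encode (x, code a))"
| "code (ExI x a) = prod_encode (9, prod_encode (x, code a))"

end

theory Submission
  imports Defs
begin

text \<open>Given a function \<open>f\<close> that decides satisfiability, diagonalise without a universal machine. Let
  \<open>F q = f (close_code q)\<close>, where \<open>close_code\<close> maps the code of a quantifier-free formula \<open>Q\<close> to the code
  of the sentence "some location holds the number \<open>code Q\<close>, and for all values of the remaining
  variables \<open>Q\<close>". Compile \<open>F\<close> to a register machine whose finite runs are stored in the heap as a
  pointer chain, one cell per register and time step. Every window of two consecutive configurations
  is a path of bounded length, so a quantifier-free \<open>Q\<close>, universally closed, can say that each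
  configuration is followed by its successor and that a halting configuration holds the result 0.
  The sentence built from this \<open>Q\<close> is satisfiable iff \<open>f\<close> maps its own code to 0, that is, iff
  it is unsatisfiable.\<close>

subsection \<open>Register machines\<close>

text \<open>Assignments take arbitrary linear terms, so integer atoms describe a machine step
  directly. Jump targets are absolute addresses, hence \<open>compile\<close> must know where its
  code is placed.\<close>

datatype instr = Asg nat iterm | JEq nat nat nat

type_synonym config = "nat \<times> (nat \<Rightarrow> int)"

fun exec :: "instr \<Rightarrow> config \<Rightarrow> config" where
  "exec (Asg r e) (pc, s) = (Suc pc, s(r := ival s e))"
| "exec (JEq r q l) (pc, s) = (if s r = s q then l else Suc pc, s)"

text \<open>Outside the program the step is the identity. A halted configuration is thus a fixed
  point, which a finite heap can store as a loop.\<close>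

definition step :: "instr list \<Rightarrow> config \<Rightarrow> config" where
  "step P c = (if fst c < length P then exec (P ! fst c) c else c)"

definition reaches :: "instr list \<Rightarrow> config \<Rightarrow> config \<Rightarrow> bool" where
  "reaches P c c' \<longleftrightarrow> (\<exists>t. (step P ^^ t) c = c')"

lemma reaches_refl: "reaches P c c"
  unfolding reaches_def by (metis funpow_0)

lemma reaches_trans:
  assumes "reaches P c c'" "reaches P c' c''" shows "reaches P c c''"
  using assms unfolding reaches_def by (metis comp_apply funpow_add)

lemma reaches_step: "step P c = c' \<Longrightarrow> reaches P c c'"
  unfolding reaches_def by (intro exI[of _ 1]) simp

fun code_at :: "instr list \<Rightarrow> nat \<Rightarrow> instr list \<Rightarrow> bool" where
  "code_at P p [] = True"
| "code_at P p (i # c) = (p < length P \<and> P ! p = i \<and> code_at P (Suc p) c)"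

lemma code_at_append [simp]:
  "code_at P p (c @ d) = (code_at P p c \<and> code_at P (p + length c) d)"
  by (induction c arbitrary: p) auto

lemma code_at_mid: "code_at (xs @ c) (length xs) c"
proof (induction c arbitrary: xs)
  case (Cons i c)
  from Cons[of "xs @ [i]"] show ?case by (simp add: nth_append)
qed simp

lemma code_at_self: "code_at P 0 P"
  using code_at_mid[of "[]"] by simp

lemma reaches_Asg:
  assumes "p < length P" "P ! p = Asg r e"
  shows "reaches P (p, s) (Suc p, s(r := ival s e))"
  using assms by (intro reaches_step) (simp add: step_def)

lemma reaches_JEq:
  assumes "p < length P" "P ! p = JEq r q l"
  shows "reaches P (p, s) (if s r = s q then l else Suc p, s)"
  using assms by (intro reaches_step) (simp add: step_def)

subsection \<open>Compiling recursive functions\<close>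

text \<open>The code for a function, placed at address \<open>p\<close>, reads its arguments in the registers
  \<open>args\<close>, all below \<open>b\<close>, leaves its result in register \<open>b\<close> and uses the registers above \<open>b\<close>
  as scratch space.\<close>

fun compile :: "recf \<Rightarrow> nat list \<Rightarrow> nat \<Rightarrow> nat \<Rightarrow> instr list"
and compiles :: "recf list \<Rightarrow> nat list \<Rightarrow> nat \<Rightarrow> nat \<Rightarrow> instr list" where
  "compile RZ args b p = [Asg b IZero]"
| "compile RS args b p = [Asg b (IPlus (IVar (hd args)) IOne)]"
| "compile (RId i) args b p = [Asg b (IVar (args ! i))]"
| "compile (RCn f gs) args b p =
     compiles gs args b p
     @ compile f [b..<b + length gs] (b + length gs) (p + length (compiles gs args b p))
     @ [Asg b (IVar (b + length gs))]"
| "compile (RPr f g) args b p =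
     (let c = compile f (tl args) b p; L = p + length c + 1;
          d = compile g (Suc b # b # tl args) (b + 2) (Suc L)
      in c @ [Asg (Suc b) IZero, JEq (Suc b) (hd args) (L + length d + 4)] @ d
         @ [Asg b (IVar (b + 2)), Asg (Suc b) (IPlus (IVar (Suc b)) IOne), JEq b b L])"
| "compile (RMn f) args b p =
     (let d = compile f (b # args) (Suc b) (Suc p)
      in Asg b IZero # d
         @ [Asg (b + 2) IZero, JEq (Suc b) (b + 2) (p + length d + 5),
            Asg b (IPlus (IVar b) IOne), JEq b b (Suc p)])"
| "compiles [] args b p = []"
| "compiles (g # gs) args b p =
     compile g args b p @ compiles gs args (Suc b) (p + length (compile g args b p))"

text \<open>Address, base register, surrounding program and state are all quantified, because the
  induction hypotheses are applied to subprograms placed elsewhere. Preserving the registers below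
  \<open>b\<close> keeps arguments and earlier results intact.\<close>

definition compile_correct :: "recf \<Rightarrow> bool" where
  "compile_correct F \<longleftrightarrow> (\<forall>xs v args b p P s.
     rec_eval F xs v \<longrightarrow> code_at P p (compile F args b p) \<longrightarrow> (\<forall>a\<in>set args. a < b) \<longrightarrow>
     map s args = map int xs \<longrightarrow>
     (\<exists>s'. reaches P (p, s) (p + length (compile F args b p), s') \<and> s' b = int v \<and>
           (\<forall>r<b. s' r = s r)))"

lemma compile_correctD:
  assumes "compile_correct F" "rec_eval F xs v" "code_at P p (compile F args b p)"
    "\<And>a. a \<in> set args \<Longrightarrow> a < b" "map s args = map int xs"
  obtains s' where "reaches P (p, s) (p + length (compile F args b p), s')" "s' b = int v"
    "\<And>r. r < b \<Longrightarrow> s' r = s r"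
  using assms unfolding compile_correct_def by blast

text \<open>Each function gets a larger base register than its predecessors, so it overwrites
  neither the arguments nor the results already computed.\<close>

lemma compiles_correct:
  assumes "\<And>g. g \<in> set gs \<Longrightarrow> compile_correct g"
    and "length ys = length gs" "\<And>i. i < length gs \<Longrightarrow> rec_eval (gs ! i) xs (ys ! i)"
    and "code_at P p (compiles gs args b p)" "\<And>a. a \<in> set args \<Longrightarrow> a < b"
    and "map s args = map int xs"
  shows "\<exists>s'. reaches P (p, s) (p + length (compiles gs args b p), s') \<and>
      map s' [b..<b + length gs] = map int ys \<and> (\<forall>r<b. s' r = s r)"
  using assms
proof (induction gs arbitrary: ys b p s)
  case Nil
  then show ?case by (auto intro: reaches_refl)
next
  case (Cons g gs)
  from Cons.prems(2) obtain y ys' where ys: "ys = y # ys'" "length ys' = length gs"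
    by (cases ys) auto
  have ev: "rec_eval g xs y" using Cons.prems(3)[of 0] ys by simp
  have evs: "rec_eval (gs ! i) xs (ys' ! i)" if "i < length gs" for i
    using Cons.prems(3)[of "Suc i"] ys that by simp
  have g: "compile_correct g" using Cons.prems(1) by simp
  have cg: "code_at P p (compile g args b p)" using Cons.prems(4) by simp
  obtain s1 where s1: "reaches P (p, s) (p + length (compile g args b p), s1)" "s1 b = int y"
      "\<And>r. r < b \<Longrightarrow> s1 r = s r"
    using compile_correctD[OF g ev cg] Cons.prems(5,6) by metis
  have "map s1 args = map int xs"
    using Cons.prems(5,6) s1(3) by (metis map_cong)
  then obtain s2 where s2:
      "reaches P (p + length (compile g args b p), s1) (p + length (compiles (g # gs) args b p), s2)"
      "map s2 [Suc b..<Suc b + length gs] = map int ys'" "\<And>r. r < Suc b \<Longrightarrow> s2 r = s1 r"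
    using Cons.IH[OF _ ys(2) evs, of "p + length (compile g args b p)" "Suc b" s1] Cons.prems
    by (fastforce simp: less_Suc_eq add.assoc)
  have "map s2 [b..<b + length (g # gs)] = map int ys"
    using s2 s1 ys by (simp add: upt_conv_Cons del: upt_Suc)
  then show ?case using reaches_trans[OF s1(1) s2(1)] s1(3) s2(3) by auto
qed

text \<open>Unrolls the recursion into the sequence \<open>ys\<close> of intermediate values, to
  which the loop invariant for \<open>RPr\<close> refers.\<close>

lemma rec_eval_RPrE:
  assumes "rec_eval (RPr f g) ks z"
  obtains k xs ys where "ks = k # xs" "rec_eval f xs (ys 0)"
    "\<And>i. i < k \<Longrightarrow> rec_eval g (i # ys i # xs) (ys (Suc i))" "ys k = z"
proof -
  have "\<exists>k xs. ks = k # xs" using assms by (cases rule: rec_eval.cases) auto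
  then obtain k xs where ks: "ks = k # xs" by blast
  have "\<exists>ys. rec_eval f xs (ys 0) \<and>
      (\<forall>i<k. rec_eval g (i # ys i # xs) (ys (Suc i))) \<and> ys k = z"
    using assms unfolding ks
  proof (induction k arbitrary: z)
    case 0
    then have "rec_eval f xs z" by (cases rule: rec_eval.cases) auto
    then show ?case by (intro exI[of _ "\<lambda>_. z"]) simp
  next
    case (Suc k)
    from Suc.prems obtain y where y: "rec_eval (RPr f g) (k # xs) y" "rec_eval g (k # y # xs) z"
      by (cases rule: rec_eval.cases) auto
    from Suc.IH[OF y(1)] obtain ys where "rec_eval f xs (ys 0)"
      "\<forall>i<k. rec_eval g (i # ys i # xs) (ys (Suc i))" "ys k = y" by blast
    then show ?case using y(2)
      by (intro exI[of _ "ys(Suc k := z)"]) (auto simp: less_Suc_eq)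
  qed
  then show thesis using that ks by blast
qed

lemma compile_correct_RCn:
  assumes f: "compile_correct f" and gs: "\<And>g. g \<in> set gs \<Longrightarrow> compile_correct g"
  shows "compile_correct (RCn f gs)"
  unfolding compile_correct_def
proof (intro allI impI)
  fix xs v args b p P s
  assume ev: "rec_eval (RCn f gs) xs v" and code: "code_at P p (compile (RCn f gs) args b p)"
    and args: "\<forall>a\<in>set args. a < b" and s: "map s args = map int xs"
  from ev obtain ys where ys: "length ys = length gs"
      "\<And>i. i < length gs \<Longrightarrow> rec_eval (gs ! i) xs (ys ! i)" "rec_eval f ys v"
    by (cases rule: rec_eval.cases) auto
  define c where "c = compiles gs args b p"
  define d where "d = compile f [b..<b + length gs] (b + length gs) (p + length c)"
  have at: "code_at P p c" "code_at P (p + length c) d"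
    "p + length c + length d < length P" "P ! (p + length c + length d) = Asg b (IVar (b + length gs))"
    using code by (simp_all add: c_def d_def)
  obtain s1 where s1: "reaches P (p, s) (p + length c, s1)"
      "map s1 [b..<b + length gs] = map int ys" "\<And>r. r < b \<Longrightarrow> s1 r = s r"
    using compiles_correct[OF gs ys(1,2) at(1)[unfolded c_def], of s] args s
    unfolding c_def by blast
  obtain s2 where s2: "reaches P (p + length c, s1) (p + length c + length d, s2)"
      "s2 (b + length gs) = int v" "\<And>r. r < b + length gs \<Longrightarrow> s2 r = s1 r"
    using compile_correctD[OF f ys(3) at(2)[unfolded d_def] _ s1(2)] unfolding d_def by auto
  have "reaches P (p + length c + length d, s2)
      (Suc (p + length c + length d), s2(b := s2 (b + length gs)))"
    using reaches_Asg[OF at(3,4), of s2] by simp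
  with s1(1) s2(1) have "reaches P (p, s) (Suc (p + length c + length d), s2(b := s2 (b + length gs)))"
    by (blast intro: reaches_trans)
  moreover have "p + length (compile (RCn f gs) args b p) = Suc (p + length c + length d)"
    by (simp add: c_def d_def)
  ultimately show "\<exists>s'. reaches P (p, s) (p + length (compile (RCn f gs) args b p), s') \<and>
      s' b = int v \<and> (\<forall>r<b. s' r = s r)"
    using s1(3) s2(2,3) by (intro exI[of _ "s2(b := s2 (b + length gs))"])
      (auto simp del: compile.simps simp: add.assoc)
qed

text \<open>Register \<open>Suc b\<close> is the loop counter, \<open>b\<close> holds the value
  reached so far, and \<open>b + 2\<close> receives the result of \<open>g\<close>. The exit test
  sits at the loop head \<open>L\<close>.\<close>

lemma compile_correct_RPr:
  assumes f: "compile_correct f" and g: "compile_correct g"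
  shows "compile_correct (RPr f g)"
  unfolding compile_correct_def
proof (intro allI impI)
  fix xs v args b p P s
  assume ev: "rec_eval (RPr f g) xs v" and code: "code_at P p (compile (RPr f g) args b p)"
    and args: "\<forall>a\<in>set args. a < b" and s: "map s args = map int xs"
  obtain k xs' ys where ys: "xs = k # xs'" "rec_eval f xs' (ys 0)"
    "\<And>i. i < k \<Longrightarrow> rec_eval g (i # ys i # xs') (ys (Suc i))" "ys k = v"
    using rec_eval_RPrE[OF ev] by metis
  from s ys(1) obtain a args' where a: "args = a # args'" "s a = int k" "map s args' = map int xs'"
    by (cases args) auto
  define c where "c = compile f args' b p"
  define L where "L = p + length c + 1"
  define d where "d = compile g (Suc b # b # args') (b + 2) (Suc L)"
  have comp: "compile (RPr f g) args b p =
      c @ [Asg (Suc b) IZero, JEq (Suc b) a (L + length d + 4)] @ d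
         @ [Asg b (IVar (b + 2)), Asg (Suc b) (IPlus (IVar (Suc b)) IOne), JEq b b L]"
    by (simp add: c_def d_def L_def a Let_def)
  have at: "code_at P p c" "code_at P (Suc L) d"
    and at1: "p + length c < length P" "P ! (p + length c) = Asg (Suc b) IZero"
    and at2: "L < length P" "P ! L = JEq (Suc b) a (L + length d + 4)"
    and at3: "Suc L + length d < length P" "P ! (Suc L + length d) = Asg b (IVar (b + 2))"
    and at4: "Suc (Suc L + length d) < length P"
      "P ! (Suc (Suc L + length d)) = Asg (Suc b) (IPlus (IVar (Suc b)) IOne)"
    and at5: "Suc (Suc (Suc L + length d)) < length P"
      "P ! (Suc (Suc (Suc L + length d))) = JEq b b L"
    using code unfolding comp by (simp_all add: L_def)
  have loop: "\<exists>s'. reaches P (p, s) (L, s') \<and> s' (Suc b) = int i \<and> s' b = int (ys i) \<and>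
      (\<forall>r<b. s' r = s r)" if "i \<le> k" for i
    using that
  proof (induction i)
    case 0
    obtain s1 where s1: "reaches P (p, s) (p + length c, s1)"
        "s1 b = int (ys 0)" "\<And>r. r < b \<Longrightarrow> s1 r = s r"
      using compile_correctD[OF f ys(2) at(1)[unfolded c_def] _ a(3)] args a(1)
      unfolding c_def by auto
    have "reaches P (p + length c, s1) (L, s1(Suc b := 0))"
      using reaches_Asg[OF at1, of s1] by (simp add: L_def)
    with s1(1) have "reaches P (p, s) (L, s1(Suc b := 0))" by (rule reaches_trans)
    with s1 show ?case
      by (intro exI[of _ "s1(Suc b := 0)"]) (auto simp del: fun_upd_apply, auto)
  next
    case (Suc i)
    then obtain s1 where s1: "reaches P (p, s) (L, s1)" "s1 (Suc b) = int i" "s1 b = int (ys i)"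
      "\<And>r. r < b \<Longrightarrow> s1 r = s r" by auto
    have "s1 a = int k" using s1(4) a args by simp
    then have r1: "reaches P (L, s1) (Suc L, s1)"
      using reaches_JEq[OF at2, of s1] Suc.prems s1(2) by simp
    have "map s1 args' = map s args'" using s1(4) a(1) args by simp
    then have args1: "map s1 (Suc b # b # args') = map int (i # ys i # xs')"
      using s1(2,3) a(3) by simp
    have lt: "x < b + 2" if "x \<in> set (Suc b # b # args')" for x
      using that args a(1) by auto
    have "i < k" using Suc.prems by simp
    then obtain s2 where s2: "reaches P (Suc L, s1) (Suc L + length d, s2)"
        "s2 (b + 2) = int (ys (Suc i))" "\<And>r. r < b + 2 \<Longrightarrow> s2 r = s1 r"
      using compile_correctD[OF g ys(3)[of i] at(2)[unfolded d_def] lt args1]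
      unfolding d_def by blast
    define s3 where "s3 = s2(b := int (ys (Suc i)))"
    define s4 where "s4 = s3(Suc b := int (Suc i))"
    have r3: "reaches P (Suc L + length d, s2) (Suc (Suc L + length d), s3)"
      using reaches_Asg[OF at3, of s2] s2(2) by (simp add: s3_def)
    have r4: "reaches P (Suc (Suc L + length d), s3) (Suc (Suc (Suc L + length d)), s4)"
      using reaches_Asg[OF at4, of s3] s2(3)[of "Suc b"] s1(2)
      by (simp add: s3_def s4_def add.commute)
    \<comment> \<open>A register always equals itself, so this \<open>JEq\<close> is an
      unconditional jump.\<close>
    have r5: "reaches P (Suc (Suc (Suc L + length d)), s4) (L, s4)"
      using reaches_JEq[OF at5, of s4] by simp
    have "reaches P (p, s) (L, s4)"
      using s1(1) r1 s2(1) r3 r4 r5 by (meson reaches_trans)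
    moreover have "s4 (Suc b) = int (Suc i)" "s4 b = int (ys (Suc i))" "\<forall>r<b. s4 r = s r"
      using s1 s2 by (simp_all add: s3_def s4_def)
    ultimately show ?case by blast
  qed
  from loop[of k] obtain s1 where s1: "reaches P (p, s) (L, s1)" "s1 (Suc b) = int k"
    "s1 b = int (ys k)" "\<And>r. r < b \<Longrightarrow> s1 r = s r" by auto
  have "s1 a = int k" using s1(4) a args by simp
  then have "reaches P (L, s1) (L + length d + 4, s1)"
    using reaches_JEq[OF at2, of s1] s1(2) by simp
  moreover have "p + length (compile (RPr f g) args b p) = L + length d + 4"
    unfolding comp by (simp add: L_def)
  ultimately show "\<exists>s'. reaches P (p, s) (p + length (compile (RPr f g) args b p), s') \<and>
      s' b = int v \<and> (\<forall>r<b. s' r = s r)"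
    using s1 ys(4) by (metis reaches_trans)
qed

text \<open>Register \<open>b\<close> holds the candidate, \<open>Suc b\<close> the value of
  \<open>f\<close> there, and \<open>b + 2\<close> a zero to compare with. Since \<open>f\<close>
  has a positive value at every smaller candidate, the loop reaches the minimum.\<close>

lemma compile_correct_RMn:
  assumes f: "compile_correct f"
  shows "compile_correct (RMn f)"
  unfolding compile_correct_def
proof (intro allI impI)
  fix xs v args b p P s
  assume ev: "rec_eval (RMn f) xs v" and code: "code_at P p (compile (RMn f) args b p)"
    and args: "\<forall>a\<in>set args. a < b" and s: "map s args = map int xs"
  from ev have zero: "rec_eval f (v # xs) 0" and pos: "\<And>i. i < v \<Longrightarrow> \<exists>y>0. rec_eval f (i # xs) y"
    by (cases rule: rec_eval.cases; auto)+
  define d where "d = compile f (b # args) (Suc b) (Suc p)"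
  define M where "M = Suc p + length d"
  have comp: "compile (RMn f) args b p = Asg b IZero # d
         @ [Asg (b + 2) IZero, JEq (Suc b) (b + 2) (p + length d + 5),
            Asg b (IPlus (IVar b) IOne), JEq b b (Suc p)]"
    by (simp add: d_def Let_def)
  have at: "code_at P (Suc p) d"
    and at1: "p < length P" "P ! p = Asg b IZero"
    and at2: "M < length P" "P ! M = Asg (b + 2) IZero"
    and at3: "Suc M < length P" "P ! Suc M = JEq (Suc b) (b + 2) (M + 4)"
    and at4: "Suc (Suc M) < length P" "P ! Suc (Suc M) = Asg b (IPlus (IVar b) IOne)"
    and at5: "Suc (Suc (Suc M)) < length P" "P ! Suc (Suc (Suc M)) = JEq b b (Suc p)"
    using code unfolding comp by (simp_all add: M_def)
  \<comment> \<open>One evaluation of \<open>f\<close>: control leaves the loop at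
    \<open>M + 4\<close> on value 0 and otherwise proceeds to the increment of the
    candidate.\<close>
  have body: "\<exists>s'. reaches P (Suc p, s1) (if y = 0 then M + 4 else Suc (Suc M), s') \<and>
      (\<forall>r\<le>b. s' r = s1 r)"
    if y: "rec_eval f (i # xs) y" and s1: "s1 b = int i" "\<And>r. r < b \<Longrightarrow> s1 r = s r" for s1 i y
  proof -
    have "map s1 args = map s args" using s1(2) args by simp
    then have args1: "map s1 (b # args) = map int (i # xs)"
      using s1(1) s by simp
    have lt: "x < Suc b" if "x \<in> set (b # args)" for x
      using that args by auto
    obtain s2 where s2: "reaches P (Suc p, s1) (M, s2)"
        "s2 (Suc b) = int y" "\<And>r. r < Suc b \<Longrightarrow> s2 r = s1 r"
      using compile_correctD[OF f y at[unfolded d_def] lt args1]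
      unfolding d_def M_def by blast
    let ?s3 = "s2(b + 2 := 0)"
    have "reaches P (M, s2) (Suc M, ?s3)"
      using reaches_Asg[OF at2, of s2] by simp
    moreover have "reaches P (Suc M, ?s3) (if y = 0 then M + 4 else Suc (Suc M), ?s3)"
      using reaches_JEq[OF at3, of ?s3] s2(2) by simp
    ultimately have "reaches P (Suc p, s1) (if y = 0 then M + 4 else Suc (Suc M), ?s3)"
      using s2(1) by (meson reaches_trans)
    then show ?thesis using s2(3) by (intro exI[of _ ?s3]) auto
  qed
  have loop: "\<exists>s'. reaches P (p, s) (Suc p, s') \<and> s' b = int i \<and> (\<forall>r<b. s' r = s r)"
    if "i \<le> v" for i
    using that
  proof (induction i)
    case 0
    have "reaches P (p, s) (Suc p, s(b := 0))" using reaches_Asg[OF at1, of s] by simp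
    moreover have "(s(b := 0)) b = int 0" "\<forall>r<b. (s(b := 0)) r = s r" by simp_all
    ultimately show ?case by blast
  next
    case (Suc i)
    then obtain s1 where s1: "reaches P (p, s) (Suc p, s1)" "s1 b = int i"
      "\<And>r. r < b \<Longrightarrow> s1 r = s r" by auto
    from pos[of i] Suc.prems obtain y where y: "y > 0" "rec_eval f (i # xs) y" by auto
    from body[OF y(2) s1(2,3)] y(1) obtain s2 where
      s2: "reaches P (Suc p, s1) (Suc (Suc M), s2)" "\<And>r. r \<le> b \<Longrightarrow> s2 r = s1 r" by auto
    let ?s3 = "s2(b := int (Suc i))"
    have r3: "reaches P (Suc (Suc M), s2) (Suc (Suc (Suc M)), ?s3)"
      using reaches_Asg[OF at4, of s2] s2(2)[of b] s1(2) by (simp add: add.commute)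
    have r4: "reaches P (Suc (Suc (Suc M)), ?s3) (Suc p, ?s3)"
      using reaches_JEq[OF at5, of ?s3] by simp
    have "reaches P (p, s) (Suc p, ?s3)"
      using s1(1) s2(1) r3 r4 by (meson reaches_trans)
    moreover have "?s3 b = int (Suc i)" "\<forall>r<b. ?s3 r = s r"
      using s1(3) s2(2) by simp_all
    ultimately show ?case by blast
  qed
  from loop[of v] obtain s1 where s1: "reaches P (p, s) (Suc p, s1)" "s1 b = int v"
    "\<And>r. r < b \<Longrightarrow> s1 r = s r" by auto
  from body[OF zero s1(2,3)] obtain s2 where
    s2: "reaches P (Suc p, s1) (M + 4, s2)" "\<And>r. r \<le> b \<Longrightarrow> s2 r = s1 r" by auto
  have "p + length (compile (RMn f) args b p) = M + 4"
    unfolding comp by (simp add: M_def)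
  then show "\<exists>s'. reaches P (p, s) (p + length (compile (RMn f) args b p), s') \<and>
      s' b = int v \<and> (\<forall>r<b. s' r = s r)"
    using s1 s2 by (intro exI[of _ s2]) (auto intro: reaches_trans)
qed

lemma compile_correct: "compile_correct F"
proof (induction F)
  case RZ
  show ?case unfolding compile_correct_def
  proof (intro allI impI)
    fix xs v args b p P s
    assume "rec_eval RZ xs v" "code_at P p (compile RZ args b p)"
    then show "\<exists>s'. reaches P (p, s) (p + length (compile RZ args b p), s') \<and> s' b = int v \<and>
        (\<forall>r<b. s' r = s r)"
      using reaches_Asg[of p P b IZero s] by (cases rule: rec_eval.cases) (intro exI[of _ "s(b := 0)"], auto)
  qed
next
  case RS
  show ?case unfolding compile_correct_def
  proof (intro allI impI)
    fix xs v args b p P s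
    assume "rec_eval RS xs v" "code_at P p (compile RS args b p)" "map s args = map int xs"
    then show "\<exists>s'. reaches P (p, s) (p + length (compile RS args b p), s') \<and> s' b = int v \<and>
        (\<forall>r<b. s' r = s r)"
      using reaches_Asg[of p P b "IPlus (IVar (hd args)) IOne" s]
      by (cases rule: rec_eval.cases) (intro exI[of _ "s(b := int v)"], cases args, auto simp: add.commute)
  qed
next
  case (RId i)
  show ?case unfolding compile_correct_def
  proof (intro allI impI)
    fix xs v args b p P s
    assume ev: "rec_eval (RId i) xs v" and "code_at P p (compile (RId i) args b p)"
      and s: "map s args = map int xs"
    have "i < length xs" "v = xs ! i" using ev by (cases rule: rec_eval.cases; simp)+
    moreover from this s have "s (args ! i) = int v" by (metis length_map nth_map)
    ultimately show "\<exists>s'. reaches P (p, s) (p + length (compile (RId i) args b p), s') \<and> s' b = int v \<and>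
        (\<forall>r<b. s' r = s r)"
      using reaches_Asg[of p P b "IVar (args ! i)" s] \<open>code_at _ _ _\<close>
      by (intro exI[of _ "s(b := int v)"]) auto
  qed
qed (simp_all add: compile_correct_RCn compile_correct_RPr compile_correct_RMn)

text \<open>Only register 0 is constrained, since in a run read off a heap the other registers start
  with unknown contents.\<close>

lemma compile_reaches:
  assumes "rec_eval F [n] v" "s 0 = int n"
  obtains s' where
    "reaches (compile F [0] 1 0) (0, s) (length (compile F [0] 1 0), s')" "s' 1 = int v"
  using compile_correctD[OF compile_correct assms(1), of "compile F [0] 1 0" 0 "[0]" 1 s] assms(2)
  by (auto simp: code_at_self)

subsection \<open>Total recursive functions\<close>

definition total_rec :: "nat \<Rightarrow> (nat list \<Rightarrow> nat) \<Rightarrow> bool" where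
  "total_rec k f \<longleftrightarrow> (\<exists>r. \<forall>xs. length xs = k \<longrightarrow> rec_eval r xs (f xs))"

lemma total_rec_cong:
  "(\<And>xs. length xs = k \<Longrightarrow> f xs = g xs) \<Longrightarrow> total_rec k f = total_rec k g"
  unfolding total_rec_def by (metis (no_types, lifting))

lemma total_rec_nth: "i < k \<Longrightarrow> total_rec k (\<lambda>xs. xs ! i)"
  unfolding total_rec_def by (metis ev_Id)

lemma total_rec_compose1:
  assumes "total_rec 1 (\<lambda>xs. f (xs ! 0))" "total_rec k a"
  shows "total_rec k (\<lambda>xs. f (a xs))"
proof -
  obtain rf ra where r: "\<And>xs. length xs = 1 \<Longrightarrow> rec_eval rf xs (f (xs ! 0))"
    "\<And>xs. length xs = k \<Longrightarrow> rec_eval ra xs (a xs)"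
    using assms unfolding total_rec_def by blast
  have "rec_eval (RCn rf [ra]) xs (f (a xs))" if "length xs = k" for xs
    using r(1)[of "[a xs]"] r(2)[OF that] by (intro ev_Cn[of "[a xs]"]) auto
  then show ?thesis unfolding total_rec_def by blast
qed

lemma total_rec_compose2:
  assumes "total_rec 2 (\<lambda>xs. f (xs ! 0) (xs ! 1))" "total_rec k a" "total_rec k b"
  shows "total_rec k (\<lambda>xs. f (a xs) (b xs))"
proof -
  obtain rf ra rb where r: "\<And>xs. length xs = 2 \<Longrightarrow> rec_eval rf xs (f (xs ! 0) (xs ! 1))"
    "\<And>xs. length xs = k \<Longrightarrow> rec_eval ra xs (a xs)"
    "\<And>xs. length xs = k \<Longrightarrow> rec_eval rb xs (b xs)"
    using assms unfolding total_rec_def by blast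
  have "rec_eval (RCn rf [ra, rb]) xs (f (a xs) (b xs))" if "length xs = k" for xs
    using r(1)[of "[a xs, b xs]"] r(2,3)[OF that]
    by (intro ev_Cn[of "[a xs, b xs]"]) (auto simp: less_Suc_eq)
  then show ?thesis unfolding total_rec_def by blast
qed

lemma total_rec_Suc:
  assumes "total_rec k a" shows "total_rec k (\<lambda>xs. Suc (a xs))"
proof (rule total_rec_compose1[OF _ assms])
  have "rec_eval RS xs (Suc (xs ! 0))" if "length xs = 1" for xs
    using that by (cases xs) (auto intro: ev_S)
  then show "total_rec 1 (\<lambda>xs. Suc (xs ! 0))" unfolding total_rec_def by blast
qed

lemma total_rec_const: "total_rec k (\<lambda>_. c)"
proof (induction c)
  case 0
  show ?case unfolding total_rec_def by (blast intro: ev_Z)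
qed (rule total_rec_Suc)

text \<open>\<open>RPr\<close> provides the witness. The form with \<open>rec_nat\<close> fits
  triangular numbers, codes of numerals and iterated quantification alike.\<close>

lemma total_rec_rec_nat:
  assumes "total_rec k f" "total_rec (Suc (Suc k)) (\<lambda>xs. g (xs ! 0) (xs ! 1) (drop 2 xs))"
  shows "total_rec (Suc k) (\<lambda>xs. rec_nat (f (tl xs)) (\<lambda>n y. g n y (tl xs)) (xs ! 0))"
proof -
  obtain rf rg where r: "\<And>xs. length xs = k \<Longrightarrow> rec_eval rf xs (f xs)"
    "\<And>xs. length xs = Suc (Suc k) \<Longrightarrow> rec_eval rg xs (g (xs ! 0) (xs ! 1) (drop 2 xs))"
    using assms unfolding total_rec_def by blast
  have "rec_eval (RPr rf rg) (n # xs) (rec_nat (f xs) (\<lambda>n y. g n y xs) n)" if "length xs = k" for n xs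
  proof (induction n)
    case 0
    show ?case using r(1)[OF that] by (auto intro: ev_Pr0)
  next
    case (Suc n)
    let ?y = "rec_nat (f xs) (\<lambda>n y. g n y xs) n"
    show ?case using ev_PrS[OF Suc] r(2)[of "n # ?y # xs"] that by simp
  qed
  then have "rec_eval (RPr rf rg) xs (rec_nat (f (tl xs)) (\<lambda>n y. g n y (tl xs)) (xs ! 0))"
    if "length xs = Suc k" for xs
    using that by (cases xs) auto
  then show ?thesis unfolding total_rec_def by blast
qed

lemma total_rec_add:
  assumes "total_rec k a" "total_rec k b" shows "total_rec k (\<lambda>xs. a xs + b xs)"
proof (rule total_rec_compose2[OF _ assms])
  have "total_rec (Suc 1) (\<lambda>xs. rec_nat (tl xs ! 0) (\<lambda>n y. Suc y) (xs ! 0))"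
    by (rule total_rec_rec_nat) (intro total_rec_Suc total_rec_nth; simp)+
  moreover have "rec_nat c (\<lambda>n y. Suc y) n = n + c" for c n :: nat
    by (induction n) auto
  ultimately show "total_rec 2 (\<lambda>xs. xs ! 0 + xs ! 1)"
    unfolding Suc_1[symmetric] by (simp add: nth_tl cong: total_rec_cong)
qed

text \<open>\<open>prod_encode\<close> is a triangular number plus its first component, so this is
  the nonlinear part of pairing.\<close>

lemma total_rec_triangle:
  assumes "total_rec k a" shows "total_rec k (\<lambda>xs. triangle (a xs))"
proof (rule total_rec_compose1[OF _ assms])
  have "total_rec (Suc 0) (\<lambda>xs. rec_nat 0 (\<lambda>n y. y + Suc n) (xs ! 0))"
    by (rule total_rec_rec_nat[where f = "\<lambda>_. 0"])
      (intro total_rec_const total_rec_add total_rec_Suc total_rec_nth; simp)+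
  moreover have "rec_nat 0 (\<lambda>n y. y + Suc n) n = triangle n" for n
    by (induction n) auto
  ultimately show "total_rec 1 (\<lambda>xs. triangle (xs ! 0))" by simp
qed

lemma total_rec_prod_encode:
  assumes "total_rec k a" "total_rec k b"
  shows "total_rec k (\<lambda>xs. prod_encode (a xs, b xs))"
  unfolding prod_encode_def using assms
  by (auto intro!: total_rec_add total_rec_triangle)

lemmas total_rec_intros =
  total_rec_prod_encode total_rec_Suc total_rec_add total_rec_nth

subsection \<open>Derived formulas and universal closure\<close>

primrec num :: "nat \<Rightarrow> iterm" where
  "num 0 = IZero"
| "num (Suc n) = IPlus IOne (num n)"

lemma ival_num [simp]: "ival si (num n) = int n"
  by (induction n) auto

lemma fvi_num [simp]: "fvi_t (num n) = {}"
  by (induction n) auto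

definition TT :: slf where "TT = EqU UNil UNil"
definition Imp :: "slf \<Rightarrow> slf \<Rightarrow> slf" where "Imp a b = Neg (Conj a (Neg b))"
definition EqI :: "iterm \<Rightarrow> iterm \<Rightarrow> slf" where "EqI a b = Conj (GeI a b) (GeI b a)"
definition Conjs :: "slf list \<Rightarrow> slf" where "Conjs fs = foldr Conj fs TT"
definition Cell :: "uterm \<Rightarrow> uterm \<Rightarrow> iterm \<Rightarrow> slf" where
  "Cell t d u = Sep (PointsTo t d u) TT"
text \<open>Allocation without quantifying over the contents: no cell at \<open>t\<close> can be
  added disjointly exactly when \<open>t\<close> is already in the domain. At nil the wand would
  hold vacuously, so nil is excluded; the contents \<open>UNil\<close> and \<open>IZero\<close> are
  arbitrary.\<close>

definition Alloc :: "uterm \<Rightarrow> slf" where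
  "Alloc t = Conj (Neg (EqU t UNil)) (Wand (PointsTo t UNil IZero) (Neg TT))"

lemma sem_TT [simp]: "sem D nl su si h TT"
  by (simp add: TT_def)

lemma sem_Imp [simp]: "sem D nl su si h (Imp a b) = (sem D nl su si h a \<longrightarrow> sem D nl su si h b)"
  by (simp add: Imp_def)

lemma sem_EqI [simp]: "sem D nl su si h (EqI a b) = (ival si a = ival si b)"
  by (auto simp: EqI_def)

lemma sem_Conjs [simp]: "sem D nl su si h (Conjs fs) = (\<forall>f\<in>set fs. sem D nl su si h f)"
  unfolding Conjs_def by (induction fs) auto

lemma sem_Cell [simp]:
  "sem D nl su si h (Cell t d u) =
     (h (uval nl su t) = Some (uval nl su d, ival si u) \<and> uval nl su t \<noteq> nl)" (is "?l = ?r")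
proof
  assume ?l
  then obtain h2 where h2: "dom [uval nl su t \<mapsto> (uval nl su d, ival si u)] \<inter> dom h2 = {}"
      "h = [uval nl su t \<mapsto> (uval nl su d, ival si u)] ++ h2" "uval nl su t \<noteq> nl"
    by (auto simp: Cell_def)
  then have "h2 (uval nl su t) = None" by auto
  then show ?r using h2(2,3) by (simp add: map_add_Some_iff)
next
  assume r: ?r
  let ?x = "uval nl su t" and ?v = "(uval nl su d, ival si u)"
  have "h = [?x \<mapsto> ?v] ++ h(?x := None)" using r by (auto simp: map_add_def fun_eq_iff split: option.split)
  moreover have "dom [?x \<mapsto> ?v] \<inter> dom (h(?x := None)) = {}" by auto
  moreover have "sem D nl su si [?x \<mapsto> ?v] (PointsTo t d u)" using r by simp
  ultimately show ?l unfolding Cell_def sem.simps(5) using sem_TT by blast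
qed

lemma sem_Alloc:
  assumes "heap_ok D h" "nl \<in> D" "uval nl su t \<in> D"
  shows "sem D nl su si h (Alloc t) = (uval nl su t \<in> dom h \<and> uval nl su t \<noteq> nl)"
proof -
  \<comment> \<open>The wand ranges over well-formed heaps only. This single cell is one, and it
    refutes the wand at an unallocated location other than nil.\<close>
  have "heap_ok D [uval nl su t \<mapsto> (nl, 0)]"
    using assms(2,3) by (simp add: heap_ok_def)
  then show ?thesis by (auto simp: Alloc_def)
qed

lemma qfree_simps [simp]:
  "qfree TT" "qfree (Imp a b) = (qfree a \<and> qfree b)" "qfree (EqI s t)"
  "qfree (Conjs fs) = (\<forall>f\<in>set fs. qfree f)" "qfree (Cell u d e)" "qfree (Alloc u)"
  by (induction fs) (auto simp: TT_def Imp_def EqI_def Conjs_def Cell_def Alloc_def)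

text \<open>\<open>prod_encode\<close> dominates both components, so codes grow from parts to
  wholes. A bound on the variables is thus available from the code without decoding it.\<close>

lemma fv_le_code: "x \<in> fvU \<phi> \<Longrightarrow> x \<le> code \<phi>" "x \<in> fvI \<phi> \<Longrightarrow> x \<le> code \<phi>"
proof -
  have u: "x \<le> code_u t" if "x \<in> fvu_t t" for t x
    using that le_prod_encode_2 by (cases t) auto
  have i: "x \<le> code_i t" if "x \<in> fvi_t t" for t x
    using that by (induction t) (auto intro: order_trans[OF _ le_prod_encode_1] order_trans[OF _ le_prod_encode_2])
  show "x \<in> fvU \<phi> \<Longrightarrow> x \<le> code \<phi>"
    by (induction \<phi>) (auto dest!: u intro: order_trans[OF _ le_prod_encode_1] order_trans[OF _ le_prod_encode_2])
  show "x \<in> fvI \<phi> \<Longrightarrow> x \<le> code \<phi>"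
    by (induction \<phi>) (auto dest!: i intro: order_trans[OF _ le_prod_encode_1] order_trans[OF _ le_prod_encode_2])
qed

text \<open>The location variables 0 and 1 are left to the existential prefix.\<close>

primrec univ :: "nat \<Rightarrow> slf \<Rightarrow> slf" where
  "univ 0 \<phi> = \<phi>"
| "univ (Suc m) \<phi> = AllU (m + 2) (AllI m (univ m \<phi>))"

text \<open>Instantiates the whole block at once, so that later proofs can choose the values as
  functions of the variable index.\<close>

lemma univ_elim:
  assumes "sem D nl su si h (univ m \<phi>)" "\<And>x. su' x \<in> D"
  shows "sem D nl (\<lambda>x. if 2 \<le> x \<and> x < m + 2 then su' x else su x)
    (\<lambda>x. if x < m then si' x else si x) h \<phi>"
  using assms(1)
proof (induction m arbitrary: su si)
  case 0
  have "(\<lambda>x. if 2 \<le> x \<and> x < 0 + 2 then su' x else su x) = su" by auto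
  with 0 show ?case by simp
next
  case (Suc m)
  then have "sem D nl (su(m + 2 := su' (m + 2))) (si(m := si' m)) h (univ m \<phi>)"
    using assms(2) by (auto simp: AllU_def AllI_def)
  note IH = Suc.IH[OF this]
  have "(\<lambda>x. if 2 \<le> x \<and> x < m + 2 then su' x else (su(m + 2 := su' (m + 2))) x)
      = (\<lambda>x. if 2 \<le> x \<and> x < Suc m + 2 then su' x else su x)"
    "(\<lambda>x. if x < m then si' x else (si(m := si' m)) x) = (\<lambda>x. if x < Suc m then si' x else si x)"
    by (auto simp: fun_eq_iff less_Suc_eq)
  with IH show ?case by simp
qed

text \<open>The block never rebinds the location variables 0 and 1, so their values are what the
  matrix may rely on.\<close>

lemma univ_intro:
  assumes "\<And>su' si'. su' 0 = su 0 \<Longrightarrow> su' 1 = su 1 \<Longrightarrow> sem D nl su' si' h \<phi>"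
  shows "sem D nl su si h (univ m \<phi>)"
  using assms by (induction m arbitrary: su si) (auto simp: AllU_def AllI_def)

lemma all_prefix_univ: "qfree \<phi> \<Longrightarrow> all_prefix (univ m \<phi>)"
  by (induction m) (auto intro: all_prefix.intros)

lemma fv_univ:
  "fvU (univ m \<phi>) = fvU \<phi> - {2..<m + 2}" "fvI (univ m \<phi>) = fvI \<phi> - {..<m}"
  by (induction m) (auto simp: AllU_def AllI_def)

text \<open>Location variable 0 names the first cell of the initial configuration, so
  \<open>n\<close> becomes the content of register 0, the input of the machine.\<close>

definition body :: "nat \<Rightarrow> slf \<Rightarrow> slf" where
  "body n Q = Conj (Cell (UVar 0) (UVar 1) (num n)) Q"

text \<open>The code of a formula bounds its variables, so \<open>Suc (code Q)\<close> universal quantifiers of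
  each sort suffice to close \<open>Q\<close>.\<close>

definition close_with_input :: "nat \<Rightarrow> slf \<Rightarrow> slf" where
  "close_with_input n Q = ExU 0 (ExU 1 (univ (Suc n) (body n Q)))"

lemma ea_sentence_close:
  assumes "qfree Q" "code Q \<le> n"
  shows "ea_sentence (close_with_input n Q)"
proof -
  have "fvU Q \<subseteq> {..n}" "fvI Q \<subseteq> {..n}"
    using fv_le_code assms(2) by (meson atMost_iff order_trans subsetI)+
  then have "sentence (close_with_input n Q)"
    by (auto simp: sentence_def close_with_input_def fv_univ body_def Cell_def TT_def simp del: univ.simps)
  moreover have "ea_prefix (close_with_input n Q)"
    using assms(1) unfolding close_with_input_def body_def
    by (intro ea_prefix.intros all_prefix_univ) auto
  ultimately show ?thesis by (simp add: ea_sentence_def)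
qed

section \<open>Computability of the closing operation on codes\<close>

lemma total_rec_code_num: "total_rec k a \<Longrightarrow> total_rec k (\<lambda>xs. code_i (num (a xs)))"
proof (rule total_rec_compose1[where f = "\<lambda>n. code_i (num n)"])
  have "total_rec (Suc 0) (\<lambda>xs. rec_nat (code_i IZero)
      (\<lambda>n y. prod_encode (3, prod_encode (code_i IOne, y))) (xs ! 0))"
    by (rule total_rec_rec_nat[where f = "\<lambda>_. code_i IZero"])
      (intro total_rec_const total_rec_intros; simp)+
  moreover have "rec_nat (code_i IZero) (\<lambda>n y. prod_encode (3, prod_encode (code_i IOne, y))) n
      = code_i (num n)" for n
    by (induction n) auto
  ultimately show "total_rec 1 (\<lambda>xs. code_i (num (xs ! 0)))" by simp
qed

text \<open>The number \<open>q\<close> plays three roles: code of the matrix, input numeral, and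
  bound on the variables to be quantified. Each round of the recursion adds the tags of one
  \<open>AllU\<close> and one \<open>AllI\<close>, both spelt out through \<open>Neg\<close> and
  \<open>Ex\<close>.\<close>

definition close_code :: "nat \<Rightarrow> nat" where
  "close_code q = prod_encode (8, prod_encode (0, prod_encode (8, prod_encode (1,
     rec_nat (prod_encode (7, prod_encode (prod_encode (4, prod_encode (prod_encode (3,
         prod_encode (code_u (UVar 0), prod_encode (code_u (UVar 1), code_i (num q)))), code TT)), q)))
       (\<lambda>j w. prod_encode (6, prod_encode (8, prod_encode (Suc (Suc j), prod_encode (6,
          prod_encode (6, prod_encode (9, prod_encode (j, prod_encode (6, w)))))))))
       (Suc q)))))"

lemma close_code: "close_code (code Q) = code (close_with_input (code Q) Q)"
proof -
  have "rec_nat (code \<phi>)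
       (\<lambda>j w. prod_encode (6, prod_encode (8, prod_encode (Suc (Suc j), prod_encode (6,
          prod_encode (6, prod_encode (9, prod_encode (j, prod_encode (6, w))))))))) m
     = code (univ m \<phi>)" for \<phi> m
    by (induction m) (simp_all add: AllU_def AllI_def)
  from this[of "body (code Q) Q" "Suc (code Q)"] show ?thesis
    unfolding close_code_def close_with_input_def by (simp add: body_def Cell_def del: old.nat.simps)
qed

lemma total_rec_close_code: "total_rec 1 (\<lambda>xs. close_code (xs ! 0))"
proof -
  let ?f = "\<lambda>xs. prod_encode (7, prod_encode (prod_encode (4, prod_encode (prod_encode (3,
         prod_encode (code_u (UVar 0), prod_encode (code_u (UVar 1), code_i (num (xs ! 0))))), code TT)), xs ! 0))"
  let ?g = "\<lambda>j w. prod_encode (6, prod_encode (8, prod_encode (Suc (Suc j), prod_encode (6,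
          prod_encode (6, prod_encode (9, prod_encode (j, prod_encode (6, w))))))))"
  \<comment> \<open>Primitive recursion needs the depth as an argument separate from the parameter;
    afterwards they are set to \<open>Suc q\<close> and \<open>q\<close>.\<close>
  have "total_rec (Suc 1) (\<lambda>xs. rec_nat (?f (tl xs)) (\<lambda>n y. ?g n y) (xs ! 0))"
    by (rule total_rec_rec_nat)
      (intro total_rec_const total_rec_intros total_rec_code_num; simp)+
  then have "total_rec 2 (\<lambda>xs. rec_nat (?f [xs ! 1]) ?g (xs ! 0))"
    unfolding Suc_1[symmetric] by (simp add: nth_tl cong: total_rec_cong)
  then have "total_rec 1 (\<lambda>xs. rec_nat (?f [xs ! 0]) ?g (Suc (xs ! 0)))"
    by (rule total_rec_compose2) (intro total_rec_intros; simp)+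
  then show ?thesis unfolding close_code_def
    by (intro total_rec_prod_encode total_rec_const) (simp only: nth_Cons_0)
qed

subsection \<open>Heaps storing runs\<close>

fun instr_vars :: "instr \<Rightarrow> nat set" where
  "instr_vars (Asg r e) = insert r (fvi_t e)"
| "instr_vars (JEq r q l) = {r, q}"

text \<open>A configuration with registers \<open>0, \<dots>, K - 1\<close> occupies \<open>K + 1\<close> consecutive cells. The last one
  holds \<open>- pc - 1\<close>: since registers are nonnegative, its sign marks the end of the block.\<close>

definition represents :: "nat \<Rightarrow> (nat \<Rightarrow> int) \<Rightarrow> config \<Rightarrow> bool" where
  "represents K f c \<longleftrightarrow> (\<forall>i<K. f i = snd c i) \<and> f K = - int (fst c) - 1"

text \<open>Terms have no subtraction, so the equation \<open>v = - pc - 1\<close> is written with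
  all summands on one side.\<close>

definition pc_is :: "nat \<Rightarrow> nat \<Rightarrow> slf" where
  "pc_is v pc = EqI (IPlus (IVar v) (num (Suc pc))) IZero"

lemma sem_pc_is [simp]: "sem D nl su si h (pc_is v pc) = (si v = - int pc - 1)"
  by (auto simp: pc_is_def)

lemma qfree_pc_is [simp]: "qfree (pc_is v pc)"
  by (simp add: pc_is_def)

text \<open>Integer variables below \<open>K\<close> are the current registers and \<open>K\<close>
  is the current counter cell; those from \<open>K + 1\<close> to \<open>2 * K\<close> are the next
  registers and \<open>2 * K + 1\<close> is the next counter cell.\<close>

fun effect :: "nat \<Rightarrow> nat \<Rightarrow> instr \<Rightarrow> slf" where
  "effect K pc (Asg r e) = Conj (pc_is (2 * K + 1) (Suc pc))
     (Conjs (map (\<lambda>i. EqI (IVar (K + 1 + i)) (if i = r then e else IVar i)) [0..<K]))"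
| "effect K pc (JEq r q l) = Conj
     (Conj (Imp (EqI (IVar r) (IVar q)) (pc_is (2 * K + 1) l))
           (Imp (Neg (EqI (IVar r) (IVar q))) (pc_is (2 * K + 1) (Suc pc))))
     (Conjs (map (\<lambda>i. EqI (IVar (K + 1 + i)) (IVar i)) [0..<K]))"

lemma ival_cong: "(\<And>x. x \<in> fvi_t e \<Longrightarrow> s x = s' x) \<Longrightarrow> ival s e = ival s' e"
  by (induction e) auto

text \<open>The bound on \<open>instr_vars\<close> ensures that the instruction reads only registers
  which the block stores.\<close>

lemma sem_effect:
  assumes "represents K si c" "instr_vars ins \<subseteq> {..<K}"
  shows "sem D nl su si h (effect K (fst c) ins) =
    represents K (\<lambda>i. si (K + 1 + i)) (exec ins c)"
proof (cases ins)
  case (Asg r e)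
  have "ival si e = ival (snd c) e"
    using assms Asg by (intro ival_cong) (auto simp: represents_def)
  then show ?thesis using assms(1) Asg
    by (cases c) (auto simp: represents_def mult_2)
next
  case (JEq r q l)
  then show ?thesis using assms
    by (cases c) (auto simp: represents_def mult_2)
qed

lemma qfree_effect [simp]: "qfree (effect K pc ins)"
  by (cases ins) auto

text \<open>A path of two block lengths: location variable \<open>j + 2\<close> is its
  \<open>j\<close>-th cell and integer variable \<open>j\<close> the number stored there.\<close>

definition window :: "nat \<Rightarrow> slf" where
  "window K = Conjs (map (\<lambda>j. Cell (UVar (j + 2)) (UVar (j + 3)) (IVar j)) [0..<2 * K + 2])"

lemma sem_window:
  "sem D nl su si h (window K) =
     (\<forall>j<2 * K + 2. h (su (j + 2)) = Some (su (j + 3), si j) \<and> su (j + 2) \<noteq> nl)"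
  unfolding window_def sem_Conjs by (auto simp del: upt_Suc)

text \<open>The first conjunct makes the chain endless. A window may start inside a block; in the
  intended model integer variable \<open>K\<close> is then a nonnegative register, so every premise
  \<open>pc_is K\<close> fails and nothing is demanded.\<close>

definition run_formula :: "nat \<Rightarrow> instr list \<Rightarrow> slf" where
  "run_formula K P =
     Conj (Imp (Cell (UVar 2) (UVar 3) (IVar 0)) (Alloc (UVar 3)))
      (Imp (window K) (Conj (Imp (EqU (UVar 0) (UVar 2)) (pc_is K 0))
       (Conj (Conjs (map (\<lambda>pc. Imp (pc_is K pc) (effect K pc (P ! pc))) [0..<length P]))
             (Imp (pc_is K (length P)) (EqI (IVar 1) IZero)))))"

lemma qfree_run_formula: "qfree (run_formula K P)"
  by (auto simp: run_formula_def window_def)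

text \<open>The bound is the last location variable of the window, so the universal block binds all
  window variables.\<close>

lemma window_le_code: "2 * K + 4 \<le> code (run_formula K P)"
proof (rule fv_le_code)
  have "fvU (Conjs fs) = (\<Union>f\<in>set fs. fvU f)" for fs
    unfolding Conjs_def by (induction fs) (auto simp: TT_def)
  then have "2 * K + 4 \<in> fvU (window K)"
    unfolding window_def by (auto simp: Cell_def intro!: bexI[of _ "2 * K + 1"])
  then show "2 * K + 4 \<in> fvU (run_formula K P)"
    by (simp add: run_formula_def Imp_def)
qed

section \<open>Models of the run formula and runs of the machine\<close>

lemma step_halted: "fst c = length P \<Longrightarrow> (step P ^^ t) c = c"
  by (induction t) (simp_all add: step_def)

text \<open>A model may contain junk cells, and its chain may loop. Following the pointers from the
  first cell still yields block after block, each forced to be the successor of the one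
  before.\<close>

lemma run_of_model:
  assumes sat: "satisfiable (close_with_input (code (run_formula K P)) (run_formula K P))"
    and K: "2 \<le> K" and vars: "\<And>ins. ins \<in> set P \<Longrightarrow> instr_vars ins \<subseteq> {..<K}"
  obtains s where "s 0 = int (code (run_formula K P))"
    "\<And>t s'. (step P ^^ t) (0, s) = (length P, s') \<Longrightarrow> s' 1 = 0"
proof -
  define Q where "Q = run_formula K P"
  define n where "n = code Q"
  have n: "2 * K + 4 \<le> n" using window_le_code by (simp add: n_def Q_def)
  from sat obtain D nl su si h where D: "nl \<in> D" "heap_ok D h"
    and univ: "sem D nl su si h (univ (Suc n) (body n Q))"
    unfolding satisfiable_def close_with_input_def n_def Q_def by auto
  define bind where "bind su' = (\<lambda>x. if 2 \<le> x \<and> x < Suc n + 2 then su' x else su x)" for su'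
  define bindI where "bindI si' = (\<lambda>x. if x < Suc n then si' x else si x)" for si'
  have inst: "sem D nl (bind su') (bindI si') h (body n Q)" if "\<And>x. su' x \<in> D" for su' si'
    using univ_elim[OF univ, of su' si'] that unfolding bind_def bindI_def by blast
  define nx where "nx x = fst (the (h x))" for x
  define vl where "vl x = snd (the (h x))" for x
  define pos where "pos x j = (nx ^^ j) x" for x j
  define R where "R x \<longleftrightarrow> x \<in> dom h \<and> x \<noteq> nl" for x
  have hR: "h x = Some (nx x, vl x)" if "R x" for x
    using that by (auto simp: R_def nx_def vl_def)
  have inD: "x \<in> D" "nx x \<in> D" if "R x" for x
    using D(2) that hR[OF that] unfolding heap_ok_def R_def by (force simp: ran_def)+
  have start: "R (su 0)" "vl (su 0) = int n"
    using inst[of "\<lambda>_. nl"] D(1) by (auto simp: body_def bind_def R_def vl_def)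
  have R_nx: "R (nx x)" if "R x" for x
  proof -
    let ?su = "bind ((\<lambda>_. nl)(2 := x, 3 := nx x))"
    have "sem D nl ?su (bindI (\<lambda>_. vl x)) h (body n Q)"
      using that D(1) inD by (intro inst) auto
    then have "sem D nl ?su (bindI (\<lambda>_. vl x)) h
        (Imp (Cell (UVar 2) (UVar 3) (IVar 0)) (Alloc (UVar 3)))"
      by (simp add: body_def Q_def run_formula_def)
    moreover have "?su 2 = x" "?su 3 = nx x" "bindI (\<lambda>_. vl x) 0 = vl x"
      using n by (auto simp: bind_def bindI_def)
    ultimately show ?thesis
      using hR[OF that] that sem_Alloc[OF D(2,1), where t = "UVar 3" and su = ?su] inD[OF that]
      by (simp add: R_def)
  qed
  have R_pos: "R (pos x j)" if "R x" for x j
    using that by (induction j) (auto simp: pos_def R_nx)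
  have local: "(x = su 0 \<longrightarrow> vl (pos x K) = - 1) \<and>
      (represents K (\<lambda>i. vl (pos x i)) c \<longrightarrow>
        (fst c < length P \<longrightarrow> represents K (\<lambda>i. vl (pos x (K + 1 + i))) (step P c)) \<and>
        (fst c = length P \<longrightarrow> snd c 1 = 0))"
    if "R x" for x c
  proof -
    \<comment> \<open>The shift by 2 makes location variable \<open>j + 2\<close> the
      \<open>j\<close>-th cell after \<open>x\<close>; variables 0 and 1 are untouched by
      \<open>bind\<close>.\<close>
    let ?su = "bind (\<lambda>j. pos x (j - 2))" and ?si = "bindI (\<lambda>j. vl (pos x j))"
    have "sem D nl ?su ?si h (body n Q)"
      using R_pos[OF that] inD by (intro inst) auto
    moreover have su: "?su (j + 2) = pos x j" if "j \<le> 2 * K + 2" for j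
      using that n by (simp add: bind_def)
    have si: "?si j = vl (pos x j)" if "j < 2 * K + 2" for j
      using that n by (simp add: bindI_def)
    have "sem D nl ?su ?si h (window K)"
    proof -
      have "h (?su (j + 2)) = Some (?su (j + 3), ?si j) \<and> ?su (j + 2) \<noteq> nl" if "j < 2 * K + 2" for j
      proof -
        have "?su (j + 3) = pos x (Suc j)" using su[of "Suc j"] that by (simp add: eval_nat_numeral)
        moreover have "h (pos x j) = Some (pos x (Suc j), vl (pos x j))"
          using hR[OF R_pos[OF \<open>R x\<close>, of j]] by (simp add: pos_def)
        ultimately show ?thesis
          using su[of j] si[of j] that R_pos[OF \<open>R x\<close>, of j] by (simp add: R_def)
      qed
      then show ?thesis unfolding sem_window by blast
    qed
    ultimately have sem: "?su 0 = ?su 2 \<longrightarrow> ?si K = - 1"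
      "\<forall>pc<length P. sem D nl ?su ?si h (Imp (pc_is K pc) (effect K pc (P ! pc)))"
      "?si K = - int (length P) - 1 \<longrightarrow> ?si 1 = 0"
      by (simp_all add: body_def Q_def run_formula_def)
    have eq: "?su 0 = su 0" "?su 2 = x" "?si K = vl (pos x K)" "?si 1 = vl (pos x 1)"
      using su[of 0] si[of K] si[of 1] by (simp_all add: bind_def pos_def numeral_2_eq_2)
    have "represents K (\<lambda>i. vl (pos x (K + 1 + i))) (step P c)"
      if c: "represents K (\<lambda>i. vl (pos x i)) c" "fst c < length P"
    proof -
      have rep: "represents K ?si c" using c(1) si by (simp add: represents_def)
      then have "sem D nl ?su ?si h (effect K (fst c) (P ! fst c))"
        using sem(2) c(2) by (simp add: represents_def)
      then have "represents K (\<lambda>i. ?si (K + 1 + i)) (step P c)"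
        using sem_effect[OF rep vars[OF nth_mem[OF c(2)]]] c(2) by (simp add: step_def)
      then show ?thesis using si by (simp add: represents_def)
    qed
    moreover have "snd c 1 = 0" if "represents K (\<lambda>i. vl (pos x i)) c" "fst c = length P"
      using that sem(3) eq K by (simp add: represents_def)
    ultimately show ?thesis using sem(1) eq by auto
  qed
  \<comment> \<open>The initial state is read off the chain. Its values from index \<open>K\<close>
    on are meaningless, and \<open>represents\<close> ignores them.\<close>
  define s where "s i = vl (pos (su 0) i)" for i
  have chain: "\<exists>x. R x \<and> represents K (\<lambda>i. vl (pos x i)) ((step P ^^ t) (0, s))" for t
  proof (induction t)
    case 0
    show ?case using start(1) local[OF start(1)]
      by (intro exI[of _ "su 0"]) (simp add: represents_def s_def)
  next
    case (Suc t)
    then obtain x where x: "R x" "represents K (\<lambda>i. vl (pos x i)) ((step P ^^ t) (0, s))" by blast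
    show ?case
    proof (cases "fst ((step P ^^ t) (0, s)) < length P")
      case True
      have "pos x (K + 1 + i) = pos (pos x (K + 1)) i" for i
        unfolding pos_def by (metis add.commute comp_apply funpow_add)
      then show ?thesis using local[OF x(1)] x(2) True R_pos[OF x(1), of "K + 1"]
        by (intro exI[of _ "pos x (K + 1)"]) simp
    next
      \<comment> \<open>The machine has stopped, so the same block represents the next configuration
        too.\<close>
      case False
      then have "(step P ^^ Suc t) (0, s) = (step P ^^ t) (0, s)" by 
        (simp add: step_def[of P "(step P ^^ t) (0, s)"])
      then show ?thesis using x by auto
    qed
  qed
  show thesis
  proof (rule that[of s])
    show "s 0 = int (code (run_formula K P))"
      using start(2) by (simp add: s_def pos_def n_def Q_def)
    fix t s' assume "(step P ^^ t) (0, s) = (length P, s')"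
    then show "s' 1 = 0" using chain[of t] local by auto
  qed
qed

section \<open>Building a model from a halting run\<close>

lemma ival_nonneg: "(\<And>i. 0 \<le> s i) \<Longrightarrow> 0 \<le> ival s e"
  by (induction e) auto

text \<open>Terms have no subtraction. Hence only the last cell of a block can be negative, which
  lets the formula detect block boundaries.\<close>

lemma step_nonneg: "(\<And>i. 0 \<le> snd c i) \<Longrightarrow> 0 \<le> snd ((step P ^^ t) c) i"
proof (induction t arbitrary: i)
  case (Suc t)
  have "0 \<le> snd (exec ins c) i" if "\<And>i. 0 \<le> snd c i" for ins c i
    using that by (cases ins; cases c) (auto intro: ival_nonneg)
  then show ?case using Suc by (simp add: step_def)
qed simp

text \<open>Cell \<open>j\<close> of configuration \<open>t\<close> is stored at \<open>prod_encode (t, j)\<close>. The halting configuration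
  points back to itself: it is its own successor, so every pointer has an allocated target.\<close>

lemma model_of_run:
  assumes halt: "(step P ^^ T) (0, s) = (length P, s')" "s' 1 = 0"
    and s: "s 0 = int n" "\<And>i. 0 \<le> s i"
    and K: "2 \<le> K" and vars: "\<And>ins. ins \<in> set P \<Longrightarrow> instr_vars ins \<subseteq> {..<K}"
  shows "satisfiable (close_with_input n (run_formula K P))"
proof -
  define c where "c t = (step P ^^ t) (0, s)" for t
  define cv where "cv t j = (if j < K then snd (c t) j else - int (fst (c t)) - 1)" for t j
  define nx where "nx t j = prod_encode (if j < K then (t, Suc j) else (min T (Suc t), 0))" for t j
  define h :: heap where "h x = (case prod_decode x of (t, j) \<Rightarrow>
      if t \<le> T \<and> j \<le> K then Some (nx t j, cv t j) else None)" for x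
  define nl where "nl = prod_encode (Suc T, 0)"
  have h_enc: "h (prod_encode (t, j)) = (if t \<le> T \<and> j \<le> K then Some (nx t j, cv t j) else None)"
    for t j by (simp add: h_def)
  have h_cases: "\<exists>t j. x = prod_encode (t, j) \<and> t \<le> T \<and> j \<le> K \<and> y = nx t j \<and> v = cv t j"
    if "h x = Some (y, v)" for x y v
  proof -
    obtain t j where "prod_decode x = (t, j)" by fastforce
    moreover from this have "x = prod_encode (t, j)" by (metis prod_decode_inverse)
    ultimately show ?thesis using that by (auto simp: h_def split: if_splits)
  qed
  have "dom h \<subseteq> prod_encode ` ({..T} \<times> {..K})"
    using h_cases by (auto simp: dom_def) blast
  then have ok: "heap_ok UNIV h"
    unfolding heap_ok_def by (meson finite_SigmaI finite_atMost finite_imageI finite_subset subset_UNIV)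
  have nl: "h nl = None" by (simp add: nl_def h_enc)
  have nx_dom: "nx t j \<in> dom h" if "t \<le> T" for t j
    using that by (auto simp: nx_def h_enc dom_def)
  \<comment> \<open>\<open>T\<close> need not be the first halting time; any earlier halted
    configuration already equals the one at \<open>T\<close>.\<close>
  have halted: "fst (c t) = length P \<Longrightarrow> t \<le> T \<Longrightarrow> c t = c T" for t
    using step_halted[of "c t" P "T - t"] unfolding c_def
    by (metis comp_apply funpow_add le_add_diff_inverse2)
  \<comment> \<open>The loop at time \<open>T\<close> is still a correct step, because the halting
    configuration is a fixed point.\<close>
  have c_min: "c (min T (Suc t)) = step P (c t)" if "t \<le> T" for t
  proof (cases "t = T")
    case True
    then show ?thesis using halt(1) by (simp add: c_def step_def)
  next
    case False
    then have "min T (Suc t) = Suc t" using that by simp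
    then show ?thesis by (simp add: c_def)
  qed
  have run: "sem UNIV nl su si h (body n (run_formula K P))"
    if su: "su 0 = prod_encode (0, 0)" "su 1 = prod_encode (0, 1)" for su si
  proof -
    have "h (su 0) = Some (su 1, int n)"
      using su s K by (simp add: h_enc nx_def cv_def c_def)
    moreover have "sem UNIV nl su si h (Imp (Cell (UVar 2) (UVar 3) (IVar 0)) (Alloc (UVar 3)))"
    proof -
      have "su 3 \<in> dom h \<and> su 3 \<noteq> nl" if "h (su 2) = Some (su 3, si 0)"
      proof -
        have "su 3 \<in> dom h" using h_cases[OF that] nx_dom by metis
        then show ?thesis using nl by auto
      qed
      then show ?thesis by (simp add: sem_Alloc[OF ok])
    qed
    moreover have "(su 0 = su 2 \<longrightarrow> si K = - 1) \<and>
        (\<forall>pc<length P. si K = - int pc - 1 \<longrightarrow> sem UNIV nl su si h (effect K pc (P ! pc))) \<and>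
        (si K = - int (length P) - 1 \<longrightarrow> si 1 = 0)"
      if "sem UNIV nl su si h (window K)"
    proof -
      have W: "h (su (a + 2)) = Some (su (a + 3), si a)" if "a < 2 * K + 2" for a
        using \<open>sem _ _ _ _ _ (window K)\<close> that unfolding sem_window by blast
      have at: "si a = cv t j \<and> su (a + 3) = nx t j"
        if "su (a + 2) = prod_encode (t, j)" "t \<le> T" "j \<le> K" "a < 2 * K + 2" for a t j
        using W[OF that(4)] that(1-3) by (simp add: h_enc)
      have block: "su (a + i + 2) = prod_encode (t, j + i)"
        if "su (a + 2) = prod_encode (t, j)" "t \<le> T" "j + i \<le> K" "a + i < 2 * K + 2" for a i t j
        using that(3,4)
      proof (induction i)
        case (Suc i)
        then show ?case using at[of "a + i" t "j + i"] that(2)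
          by (simp add: nx_def eval_nat_numeral)
      qed (use that in simp)
      have val: "si (a + i) = cv t (j + i)"
        if "su (a + 2) = prod_encode (t, j)" "t \<le> T" "j + i \<le> K" "a + i < 2 * K + 2" for a i t j
        using at[OF block[OF that] that(2-4)] by simp
      have "next": "su (a + i + 3) = prod_encode (min T (Suc t), 0)"
        if "su (a + 2) = prod_encode (t, j)" "t \<le> T" "j + i = K" "a + i < 2 * K + 2" for a i t j
        using at[OF block[of a t j i]] that by (simp add: nx_def)
      have "si K = - 1" if "su 0 = su 2"
        using val[of 0 0 0 K, unfolded add_0] that su(1) by (simp add: cv_def c_def)
      moreover have "sem UNIV nl su si h (effect K (fst (c t)) (P ! fst (c t)))"
        if "su 2 = prod_encode (t, 0)" "t \<le> T" "fst (c t) < length P" for t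
      proof -
        have "represents K si (c t)"
          using val[of 0 t 0, unfolded add_0] that by (simp add: represents_def cv_def)
        moreover have "su (Suc K + 2) = prod_encode (min T (Suc t), 0)"
          using "next"[of 0 t 0 K, unfolded add_0] that by (simp add: eval_nat_numeral)
        then have "represents K (\<lambda>i. si (K + 1 + i)) (step P (c t))"
          using val[of "Suc K" "min T (Suc t)" 0] c_min[OF that(2)]
          by (simp add: represents_def cv_def)
        ultimately show ?thesis
          using sem_effect[of K si "c t" "P ! fst (c t)"] vars[OF nth_mem[OF that(3)]] that(3)
          by (simp add: step_def)
      qed
      moreover have "si 1 = 0"
        if "su 2 = prod_encode (t, 0)" "t \<le> T" "fst (c t) = length P" for t
        using val[of 0 t 0 1, unfolded add_0] that halted[OF that(3,2)] halt K by (simp add: cv_def c_def)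
      \<comment> \<open>A negative value in integer variable \<open>K\<close> forces the window to
        start at a block. From offset \<open>j > 0\<close>, cell \<open>K\<close> of the window
        would be register \<open>j - 1\<close> of the next block, which is nonnegative.\<close>
      moreover have "\<exists>t\<le>T. su 2 = prod_encode (t, 0) \<and> si K = - int (fst (c t)) - 1"
        if neg: "si K < 0"
      proof -
        obtain t j where tj: "su 2 = prod_encode (t, j)" "t \<le> T" "j \<le> K"
          using h_cases[OF W[of 0, unfolded add_0]] by auto
        have "j = 0"
        proof (rule ccontr)
          assume "j \<noteq> 0"
          have "su (K - j + 3) = prod_encode (min T (Suc t), 0)"
            using "next"[of 0 t j "K - j", unfolded add_0] tj by simp
          then have "su (Suc (K - j) + 2) = prod_encode (min T (Suc t), 0)"
            by (simp add: eval_nat_numeral)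
          then have "si (Suc (K - j) + (j - 1)) = cv (min T (Suc t)) (0 + (j - 1))"
            using tj(3) by (intro val) auto
          moreover have "Suc (K - j) + (j - 1) = K" "j - 1 < K"
            using tj(3) \<open>j \<noteq> 0\<close> by auto
          ultimately have "si K = snd (c (min T (Suc t))) (j - 1)"
            by (simp add: cv_def)
          moreover have "0 \<le> snd (c (min T (Suc t))) (j - 1)"
            unfolding c_def by (intro step_nonneg) (simp add: s(2))
          ultimately show False using neg by simp
        qed
        then show ?thesis using tj val[of 0 t 0 K, unfolded add_0] by (auto simp: cv_def)
      qed
      ultimately show ?thesis by (smt (verit) of_nat_0_le_iff of_nat_eq_iff)
    qed
    ultimately show ?thesis
      using nl by (auto simp: body_def run_formula_def)
  qed
  have "sem UNIV nl ((\<lambda>_. nl)(0 := prod_encode (0, 0), 1 := prod_encode (0, 1))) (\<lambda>_. 0) h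
      (univ (Suc n) (body n (run_formula K P)))"
    by (intro univ_intro run) simp_all
  then have "sem UNIV nl (\<lambda>_. nl) (\<lambda>_. 0) h (close_with_input n (run_formula K P))"
    unfolding close_with_input_def sem.simps by blast
  then show ?thesis
    using ok unfolding satisfiable_def by blast
qed

section \<open>The diagonal argument\<close>

theorem theorem5:
  shows "\<not> (\<exists>f. \<forall>\<phi>. ea_sentence \<phi> \<longrightarrow>
              rec_eval f [code \<phi>] (if satisfiable \<phi> then 1 else 0))"
proof
  assume "\<exists>f. \<forall>\<phi>. ea_sentence \<phi> \<longrightarrow> rec_eval f [code \<phi>] (if satisfiable \<phi> then 1 else 0)"
  then obtain f where f: "\<And>\<phi>. ea_sentence \<phi> \<Longrightarrow>
      rec_eval f [code \<phi>] (if satisfiable \<phi> then 1 else 0)" by blast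
  obtain d where d: "\<And>q. rec_eval d [q] (close_code q)"
    using total_rec_close_code unfolding total_rec_def
    by (metis One_nat_def length_Cons list.size(3) nth_Cons_0)
  define F where "F = RCn f [d]"
  define P where "P = compile F [0] 1 0"
  have fin: "finite (\<Union>ins\<in>set P. instr_vars ins)"
  proof -
    have "finite (fvi_t e)" for e by (induction e) auto
    then have "finite (instr_vars ins)" for ins by (cases ins) auto
    then show ?thesis by blast
  qed
  \<comment> \<open>At least 2, so that a block stores the input register 0 and the result register
    1.\<close>
  obtain K where K: "2 \<le> K" "\<And>ins. ins \<in> set P \<Longrightarrow> instr_vars ins \<subseteq> {..<K}"
  proof -
    obtain k where "(\<Union>ins\<in>set P. instr_vars ins) \<subseteq> {..<k}"
      using fin unfolding finite_nat_set_iff_bounded by blast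
    then show thesis by (intro that[of "k + 2"]) fastforce+
  qed
  \<comment> \<open>There is no circularity: \<open>P\<close> depends on \<open>f\<close> only, and
    the code of \<open>Q\<close> enters later as the input.\<close>
  define Q where "Q = run_formula K P"
  define \<phi> where "\<phi> = close_with_input (code Q) Q"
  define v where "v = (if satisfiable \<phi> then 1 else 0 :: nat)"
  have "rec_eval f [code \<phi>] v"
    unfolding v_def \<phi>_def Q_def by (intro f ea_sentence_close qfree_run_formula) simp
  then have "rec_eval F [code Q] v"
    using d[of "code Q"] unfolding F_def
    by (intro ev_Cn[of "[code \<phi>]"]) (auto simp: close_code \<phi>_def)
  then have halts: "\<exists>t s'. (step P ^^ t) (0, s) = (length P, s') \<and> s' 1 = int v"
    if "s 0 = int (code Q)" for s
    using compile_reaches[of F "code Q" v s] that unfolding P_def reaches_def by metis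
  have "satisfiable \<phi> \<longleftrightarrow> v = 0"
  proof
    assume "satisfiable \<phi>"
    then show "v = 0"
      using run_of_model[OF _ K] halts unfolding \<phi>_def Q_def by (metis of_nat_eq_0_iff)
  next
    assume "v = 0"
    then show "satisfiable \<phi>"
      \<comment> \<open>A constant state suffices: register 0 holds the input and all registers are
        nonnegative.\<close>
      using halts[of "\<lambda>_. int (code Q)"] model_of_run[OF _ _ _ _ K, where s = "\<lambda>_. int (code Q)"]
      unfolding \<phi>_def Q_def by auto
  qed
  then show False by (auto simp: v_def split: if_splits)
qed

end
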